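(* For every fixed integer $k>1$ the following holds. Let $H=(V,\mathcal{E})$ be a hypergraph with $n$ vertices and at most $m$ hyperedges. Then $\chi_{k\text{-cf}}(H)=O\!\left(m^{\frac{1}{k+1}}\log^{\frac{k}{k+1}} n\right)$.
   Context: For a hypergraph $H=(V,\mathcal{E})$ and $k\in\mathbb{N}$, a $k$-CF-coloring is a map $c:V\to\mathbb{N}$ such that every (nonempty) hyperedge $S\in\mathcal{E}$ contains a color $i$ with $1\le|S\cap c^{-1}(i)|\le k$. $\chi_{k\text{-cf}}(H)$ is the minimum number of colors in a $k$-CF-coloring of $H$. *)

theory Defs
  imports Complex_Main
begin

definition hypergraph :: "'a set \<Rightarrow> 'a set set \<Rightarrow> bool" where
  "hypergraph V E \<longleftrightarrow> finite V \<and> E \<subseteq> Pow V"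

definition k_cf_coloring :: "nat \<Rightarrow> 'a set \<Rightarrow> 'a set set \<Rightarrow> ('a \<Rightarrow> nat) \<Rightarrow> bool" where
  "k_cf_coloring k V E c \<longleftrightarrow>
     (\<forall>S\<in>E. S \<noteq> {} \<longrightarrow>
        (\<exists>i. 1 \<le> card (S \<inter> {v\<in>V. c v = i}) \<and> card (S \<inter> {v\<in>V. c v = i}) \<le> k))"

text \<open>Colorings are total functions, so only the values on \<open>V\<close> count as colors used.
  For a finite vertex set and \<open>k \<ge> 1\<close> the minimum is attained by some coloring, since any
  coloring injective on \<open>V\<close> is admissible.\<close>

definition chi_k_cf :: "nat \<Rightarrow> 'a set \<Rightarrow> 'a set set \<Rightarrow> nat" where
  "chi_k_cf k V E = (LEAST q. \<exists>c. k_cf_coloring k V E c \<and> card (c ` V) = q)"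

end

theory Submission
  imports Defs "HOL-Library.FuncSet"
begin

text \<open>
  Put \<open>L = ln n\<close> and \<open>D = (m / L) powr (k / (k + 1))\<close>. Giving unique colors to a maximal set \<open>U\<close> of
  vertices that meets at least \<open>D * card U\<close> hyperedges costs at most \<open>m / D\<close> colors, and every
  vertex lies in fewer than \<open>D\<close> of the hyperedges missed by \<open>U\<close>. For those, let \<open>r ^ k \<ge> D\<close>. Among
  the still uncolored vertices \<open>W\<close>, the deletion method (pick each vertex with probability \<open>1 / r\<close>, then
  drop one vertex per bad hyperedge) finds \<open>I \<subseteq> W\<close> with \<open>card I \<ge> card W / (2 * r)\<close> that contains no
  trace on \<open>W\<close> of size more than \<open>k\<close>. Color \<open>I\<close> with a fresh color and repeat on \<open>W - I\<close>; the last
  color that a hyperedge receives appears in it at most \<open>k\<close> times. This needs at most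
  \<open>2 * r * L + 1\<close> rounds, and \<open>m / D\<close> and \<open>r * L\<close> balance. If \<open>m \<le> L\<close>, uniquely coloring one vertex
  per hyperedge suffices.
\<close>

section \<open>Random subsets and the deletion method, by counting functions\<close>

lemma card_PiE_vanishing_on:
  assumes "finite W" "A \<subseteq> W" "r \<ge> 1"
  shows "real (card {f \<in> W \<rightarrow>\<^sub>E {..<r}. \<forall>v\<in>A. f v = 0}) = real r ^ card W / real r ^ card A"
proof -
  have "{f \<in> W \<rightarrow>\<^sub>E {..<r}. \<forall>v\<in>A. f v = 0} = (\<Pi>\<^sub>E v\<in>W. if v \<in> A then {0} else {..<r})"
    (is "?L = ?R")
  proof
    show "?L \<subseteq> ?R" by (auto simp: PiE_iff extensional_def)
    show "?R \<subseteq> ?L"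
    proof
      fix f assume f: "f \<in> ?R"
      have "f v < r" if "v \<in> W" for v
        using PiE_mem[OF f that] assms(3) by (auto split: if_splits)
      moreover have "f v = 0" if "v \<in> A" for v
        using PiE_mem[OF f, of v] that assms(2) by auto
      ultimately show "f \<in> ?L" using f by (auto simp: PiE_iff)
    qed
  qed
  then have "card ?L = (\<Prod>v\<in>W. if v \<in> A then 1 else r)"
    using assms(1) by (simp add: card_PiE if_distrib cong: if_cong)
  also have "\<dots> = r ^ card (W - A)"
    using assms(1,2) by (simp add: prod.If_cases Int_absorb1 Diff_eq)
  also have "card (W - A) = card W - card A"
    using assms by (simp add: card_Diff_subset finite_subset)
  finally show ?thesis
    using assms(3) card_mono[OF assms(1,2)] power_diff[of "real r" "card A" "card W"]
    by (metis not_one_le_zero of_nat_eq_0_iff of_nat_power)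
qed

text \<open>Average \<open>card (Z f) - card (B f)\<close> over all functions \<open>f\<close>. The
  mean of \<open>card (Z f)\<close> is \<open>card W / r\<close>. A trace with at least
  \<open>k + 1\<close> vertices lies in \<open>Z f\<close> for at most a fraction
  \<open>1 / r ^ (k + 1)\<close> of the \<open>f\<close>, so by \<open>few\<close> the bad traces
  cost at most half of that mean.\<close>

lemma large_subset_avoiding_traces:
  fixes W :: "'a set" and F :: "'a set set"
  assumes "finite W" "finite F" "r \<ge> 1"
    and large: "\<And>S. S \<in> F \<Longrightarrow> k < card (S \<inter> W)"
    and few: "2 * real (card F) \<le> real (card W) * real r ^ k"
  obtains I where "I \<subseteq> W" "real (card W) \<le> 2 * real r * real (card I)"
    "\<And>S. S \<in> F \<Longrightarrow> \<not> S \<inter> W \<subseteq> I"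
proof -
  \<comment> \<open>\<open>P\<close> is the uniform sample space: value \<open>0\<close>, of
    frequency \<open>1 / r\<close>, means that a vertex is picked. \<open>Z f\<close> is the picked
    set and \<open>B f\<close> the hyperedges whose whole trace is picked.\<close>
  define P where "P = W \<rightarrow>\<^sub>E {..<r}"
  define Z where "Z f = {v \<in> W. f v = 0}" for f :: "'a \<Rightarrow> nat"
  define B where "B f = {S \<in> F. S \<inter> W \<subseteq> Z f}" for f
  have P: "finite P" "real (card P) = real r ^ card W"
    using assms by (simp_all add: P_def finite_PiE card_PiE)
  have "(\<Sum>f\<in>P. real (card (Z f))) = (\<Sum>f\<in>P. \<Sum>v\<in>W. of_bool (f v = 0))"
    using assms(1) by (simp add: Z_def Int_def)
  also have "\<dots> = (\<Sum>v\<in>W. real (card {f \<in> P. \<forall>v\<in>{v}. f v = 0}))"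
    using P(1) by (subst sum.swap) (simp add: Int_def)
  also have "\<dots> = real r ^ card W * (real (card W) / real r)"
    proof -
    have "real (card {f \<in> P. \<forall>v\<in>{v}. f v = 0}) = real r ^ card W / real r" if "v \<in> W" for v
      using card_PiE_vanishing_on[of W "{v}" r] assms(1,3) that by (simp add: P_def)
    then show ?thesis by simp
  qed
  finally have sumZ: "(\<Sum>f\<in>P. real (card (Z f))) = real r ^ card W * (real (card W) / real r)" .
  have "(\<Sum>f\<in>P. real (card (B f))) = (\<Sum>f\<in>P. \<Sum>S\<in>F. of_bool (\<forall>v\<in>S \<inter> W. f v = 0))"
    using assms(2) by (auto simp: B_def Z_def Int_def subset_iff intro!: sum.cong arg_cong[where f=card])
  also have "\<dots> = (\<Sum>S\<in>F. real (card {f \<in> P. \<forall>v\<in>S \<inter> W. f v = 0}))"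
    using P(1) by (subst sum.swap) (simp add: Int_def)
  also have "\<dots> = (\<Sum>S\<in>F. real r ^ card W / real r ^ card (S \<inter> W))"
    unfolding P_def using assms(1,3) by (intro sum.cong refl card_PiE_vanishing_on) auto
  also have "\<dots> \<le> (\<Sum>S\<in>F. real r ^ card W / real r ^ (k + 1))"
    using assms(3) large by (intro sum_mono divide_left_mono power_increasing) (auto simp: Suc_le_eq)
  also have "\<dots> = real r ^ card W * (real (card F) / real r ^ (k + 1))" by simp
  also have "\<dots> \<le> real r ^ card W * (real (card W) / (2 * real r))"
    using few assms(3) by (intro mult_left_mono) (auto simp: field_simps)
  finally have sumB: "(\<Sum>f\<in>P. real (card (B f))) \<le> real r ^ card W * (real (card W) / (2 * real r))" .
  have "\<exists>f\<in>P. real (card W) / (2 * real r) \<le> real (card (Z f)) - real (card (B f))"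
  proof (rule ccontr)
    assume "\<not> ?thesis"
    then have "(\<Sum>f\<in>P. real (card (Z f)) - real (card (B f))) < (\<Sum>f\<in>P. real (card W) / (2 * real r))"
      using P assms(3) by (intro sum_strict_mono) (auto simp: not_le)
    then show False using sumZ sumB P(2) assms(3) by (simp add: sum_subtractf field_simps)
  qed
  then obtain f where f: "real (card W) / (2 * real r) \<le> real (card (Z f)) - real (card (B f))"
    by blast
  have "\<exists>x. x \<in> S \<inter> W" if "S \<in> F" for S
    using large[OF that] by (metis card.empty ex_in_conv less_nat_zero_code)
  \<comment> \<open>Deleting the representative \<open>x S\<close> breaks each bad trace; a trace
    that is not bad already leaves \<open>Z f\<close>.\<close>
  then obtain x where x: "\<And>S. S \<in> F \<Longrightarrow> x S \<in> S \<inter> W" by metis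
  define I where "I = Z f - x ` B f"
  show thesis
  proof
    show "I \<subseteq> W" by (auto simp: I_def Z_def)
    have "finite (B f)" using assms(2) by (simp add: B_def)
    then have "real (card (Z f)) - real (card (B f)) \<le> real (card I)"
      using diff_card_le_card_Diff[of "x ` B f" "Z f"] card_image_le[of "B f" x]
      unfolding I_def by simp
    with f have "real (card W) / (2 * real r) \<le> real (card I)" by simp
    then show "real (card W) \<le> 2 * real r * real (card I)"
      using assms(3) by (simp add: field_simps)
    show "\<not> S \<inter> W \<subseteq> I" if "S \<in> F" for S
      using x[OF that] that by (auto simp: I_def B_def)
  qed
qed

section \<open>Round-by-round coloring under a degree bound\<close>

lemma k_cf_coloringE:
  assumes "k_cf_coloring k V E c" "S \<in> E" "S \<noteq> {}"
  obtains i where "i \<in> c ` V" "1 \<le> card (S \<inter> {v \<in> V. c v = i})" "card (S \<inter> {v \<in> V. c v = i}) \<le> k"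
proof -
  from assms obtain i where i: "1 \<le> card (S \<inter> {v \<in> V. c v = i})"
    "card (S \<inter> {v \<in> V. c v = i}) \<le> k"
    unfolding k_cf_coloring_def by metis
  then have "S \<inter> {v \<in> V. c v = i} \<noteq> {}" by (metis card.empty not_one_le_zero)
  then have "i \<in> c ` V" by auto
  with i show thesis using that by simp
qed

text \<open>The potential \<open>2 * r * ln (card W)\<close> drops by at least 1 per round, which
  pays for the fresh color; the final \<open>+ 1\<close> pays for the last round. Working with
  traces keeps \<open>E\<close> and its degree bound fixed while \<open>W\<close> shrinks.\<close>

lemma k_cf_coloring_bounded_degree:
  fixes W :: "'a set" and E :: "'a set set" and D :: real
  assumes "finite W" "W \<noteq> {}" "finite E" "k \<ge> 1" "r \<ge> 1" "D \<le> real r ^ k"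
    and "\<And>v. v \<in> W \<Longrightarrow> real (card {S \<in> E. v \<in> S}) \<le> D"
  shows "\<exists>c. k_cf_coloring k W ((\<inter>) W ` E) c \<and>
    real (card (c ` W)) \<le> 2 * real r * ln (real (card W)) + 1"
  using assms(1,2,7)
proof (induction W rule: finite_psubset_induct)
  case (psubset W)
  define F where "F = {S \<in> E. k < card (S \<inter> W)}"
  have finF: "finite F" using assms(3) by (simp add: F_def)
  \<comment> \<open>Count incidences between \<open>F\<close> and \<open>W\<close>: since
    \<open>k \<ge> 1\<close>, each trace from \<open>F\<close> has at least 2 vertices, and each
    vertex has degree at most \<open>D \<le> r ^ k\<close>.\<close>
  have "2 * real (card F) \<le> (\<Sum>S\<in>F. real (card (S \<inter> W)))"
    using assms(4) sum_bounded_below[of F "2::real" "\<lambda>S. real (card (S \<inter> W))"]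
    by (force simp: F_def mult.commute)
  also have "\<dots> = (\<Sum>S\<in>F. \<Sum>v\<in>W. of_bool (v \<in> S))"
    using psubset.hyps by (simp add: Int_def conj_commute)
  also have "\<dots> = (\<Sum>v\<in>W. real (card {S \<in> F. v \<in> S}))"
    using finF by (subst sum.swap) (simp add: Int_def)
  also have "\<dots> \<le> (\<Sum>v\<in>W. real r ^ k)"
  proof (rule sum_mono)
    fix v assume "v \<in> W"
    have "card {S \<in> F. v \<in> S} \<le> card {S \<in> E. v \<in> S}"
      using assms(3) by (intro card_mono) (auto simp: F_def)
    with psubset.prems(2)[OF \<open>v \<in> W\<close>] assms(6) show "real (card {S \<in> F. v \<in> S}) \<le> real r ^ k"
      by linarith
  qed
  finally have few: "2 * real (card F) \<le> real (card W) * real r ^ k" by simp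
  obtain I where I: "I \<subseteq> W"
    "real (card W) \<le> 2 * real r * real (card I)" "\<And>S. S \<in> F \<Longrightarrow> \<not> S \<inter> W \<subseteq> I"
    by (rule large_subset_avoiding_traces[OF psubset.hyps(1) finF assms(5) _ few])
      (auto simp: F_def)
  have posW: "card W > 0" using psubset by (simp add: card_gt_0_iff)
  have finI: "finite I" using I(1) psubset.hyps finite_subset by blast
  have "card I > 0" using I(2) posW by (cases "card I") auto
  then have "I \<noteq> {}" by auto
  then have sub: "W - I \<subset> W" using I(1) by auto
  obtain c' where c': "k_cf_coloring k (W - I) ((\<inter>) (W - I) ` E) c'"
    and bound: "real (card (c' ` (W - I))) + 1 \<le> 2 * real r * ln (real (card W)) + 1"
  proof (cases "W - I = {}")
    case True
    \<comment> \<open>All remaining traces are empty, so any coloring serves and uses no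
      colors.\<close>
    then show ?thesis using that[of undefined] posW unfolding k_cf_coloring_def True by simp
  next
    case False
    have ex: "\<exists>c. k_cf_coloring k (W - I) ((\<inter>) (W - I) ` E) c \<and>
      real (card (c ` (W - I))) \<le> 2 * real r * ln (real (card (W - I))) + 1"
      using psubset.IH[OF sub False] psubset.prems(2) by blast
    have pos': "card (W - I) > 0" using False psubset.hyps by (simp add: card_gt_0_iff)
    have eq: "real (card (W - I)) = real (card W) - real (card I)"
      using I(1) finI psubset.hyps by (simp add: card_Diff_subset card_mono of_nat_diff)
    \<comment> \<open>Since \<open>ln t \<le> t - 1\<close>, removing a fraction of at least
      \<open>1 / (2 * r)\<close> of \<open>W\<close> lowers the logarithm by at least that
      fraction.\<close>
    have "ln (real (card (W - I))) - ln (real (card W)) = ln (real (card (W - I)) / real (card W))"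
      using posW pos' by (simp add: ln_div)
    also have "\<dots> \<le> real (card (W - I)) / real (card W) - 1"
      using posW pos' by (intro ln_le_minus_one) simp
    also have "\<dots> = - (real (card I) / real (card W))" using posW by (simp add: eq field_simps)
    finally have "2 * real r * (ln (real (card (W - I))) - ln (real (card W)))
        \<le> 2 * real r * - (real (card I) / real (card W))"
      by (intro mult_left_mono) auto
    also have "\<dots> \<le> - 1" using I(2) posW by (simp add: field_simps)
    finally show ?thesis using ex that by (fastforce simp: algebra_simps)
  qed
  obtain i0 where i0: "i0 \<notin> c' ` (W - I)"
    using psubset.hyps ex_new_if_finite[of "c' ` (W - I)"] by auto
  define c where "c v = (if v \<in> I then i0 else c' v)" for v
  have "c ` W \<subseteq> insert i0 (c' ` (W - I))" by (auto simp: c_def)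
  then have "card (c ` W) \<le> card (insert i0 (c' ` (W - I)))"
    using psubset.hyps by (intro card_mono) auto
  also have "\<dots> \<le> card (c' ` (W - I)) + 1" using psubset.hyps i0 by simp
  finally have num: "real (card (c ` W)) \<le> 2 * real r * ln (real (card W)) + 1"
    using bound by linarith
  have "\<exists>i. 1 \<le> card (W \<inter> S \<inter> {v \<in> W. c v = i}) \<and> card (W \<inter> S \<inter> {v \<in> W. c v = i}) \<le> k"
    if S: "S \<in> E" "W \<inter> S \<noteq> {}" for S
  \<comment> \<open>A trace inside \<open>I\<close> is not from \<open>F\<close>, so
    \<open>i0\<close> serves it. Any other trace still meets \<open>W - I\<close>; its color from
    \<open>c'\<close> is used there, differs from \<open>i0\<close>, and keeps its class.\<close>
  proof (cases "S \<inter> W \<subseteq> I")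
    case True
    then have "W \<inter> S \<inter> {v \<in> W. c v = i0} = S \<inter> W" by (auto simp: c_def)
    moreover have "card (S \<inter> W) \<le> k" using I(3)[of S] S True by (force simp: F_def)
    moreover have "card (S \<inter> W) \<ge> 1"
      using S(2) psubset.hyps by (simp add: Suc_le_eq card_gt_0_iff Int_commute)
    ultimately show ?thesis by metis
  next
    case False
    then have "(W - I) \<inter> S \<noteq> {}" by auto
    with c' S(1) obtain i where i: "i \<in> c' ` (W - I)"
      "1 \<le> card ((W - I) \<inter> S \<inter> {v \<in> W - I. c' v = i})"
      "card ((W - I) \<inter> S \<inter> {v \<in> W - I. c' v = i}) \<le> k"
      by (elim k_cf_coloringE) auto
    from i(1) have "i \<noteq> i0" using i0 by auto
    then have "W \<inter> S \<inter> {v \<in> W. c v = i} = (W - I) \<inter> S \<inter> {v \<in> W - I. c' v = i}"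
      by (auto simp: c_def)
    then show ?thesis using i by metis
  qed
  then have "k_cf_coloring k W ((\<inter>) W ` E) c" by (simp add: k_cf_coloring_def)
  with num show ?case by blast
qed

section \<open>Removing vertices of high degree by unique colors\<close>

lemma exists_degree_reducing_set:
  fixes V :: "'a set" and E :: "'a set set" and D :: real
  assumes "finite V" "finite E"
  obtains U where "U \<subseteq> V" "D * real (card U) \<le> real (card E)"
    "\<And>v. v \<in> V - U \<Longrightarrow> real (card {S \<in> {S \<in> E. S \<inter> U = {}}. v \<in> S}) < D"
proof -
  \<comment> \<open>\<open>{}\<close> qualifies, so a maximal member exists. A vertex lying in
    \<open>D\<close> or more missed hyperedges could be added to it, against maximality.\<close>
  define \<U> where "\<U> = {U \<in> Pow V. D * real (card U) \<le> real (card {S \<in> E. S \<inter> U \<noteq> {}})}"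
  have "finite \<U>" "{} \<in> \<U>" using assms(1) by (auto simp: \<U>_def)
  then obtain U where U: "U \<in> \<U>" "\<And>X. X \<in> \<U> \<Longrightarrow> U \<subseteq> X \<Longrightarrow> U = X"
    using finite_has_maximal[of \<U>] by blast
  have finU: "finite U" using U(1) assms(1) finite_subset by (auto simp: \<U>_def)
  show thesis
  proof
    show "U \<subseteq> V" using U(1) by (simp add: \<U>_def)
    have "card {S \<in> E. S \<inter> U \<noteq> {}} \<le> card E" using assms(2) by (intro card_mono) auto
    then show "D * real (card U) \<le> real (card E)" using U(1) by (simp add: \<U>_def)
    fix v assume v: "v \<in> V - U"
    show "real (card {S \<in> {S \<in> E. S \<inter> U = {}}. v \<in> S}) < D"
    proof (rule ccontr)
      assume "\<not> ?thesis"
      moreover have "card {S \<in> E. S \<inter> insert v U \<noteq> {}} =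
          card ({S \<in> E. S \<inter> U \<noteq> {}} \<union> {S \<in> {S \<in> E. S \<inter> U = {}}. v \<in> S})"
        by (rule arg_cong[where f=card]) auto
      moreover have "\<dots> = card {S \<in> E. S \<inter> U \<noteq> {}} + card {S \<in> {S \<in> E. S \<inter> U = {}}. v \<in> S}"
        using assms(2) by (intro card_Un_disjoint) auto
      ultimately have "insert v U \<in> \<U>"
        using U(1) v finU by (auto simp: \<U>_def algebra_simps)
      then show False using U(2)[of "insert v U"] v by auto
    qed
  qed
qed

text \<open>A hyperedge meeting \<open>U\<close> is served by the unique color of one of its
  vertices in \<open>U\<close>. One that misses \<open>U\<close> equals its trace on
  \<open>V - U\<close> and keeps its color from \<open>c\<close>, as the colors on \<open>U\<close>
  are chosen outside the range of \<open>c\<close> on \<open>V - U\<close>.\<close>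

lemma chi_k_cf_le_unique_colors:
  assumes "finite V" "U \<subseteq> V" "k \<ge> 1"
    and c: "k_cf_coloring k (V - U) ((\<inter>) (V - U) ` {S \<in> E. S \<inter> U = {}}) c"
    and E: "E \<subseteq> Pow V"
  shows "chi_k_cf k V E \<le> card U + card (c ` (V - U))"
proof -
  have finU: "finite U" using assms(1,2) finite_subset by blast
  have "infinite (- c ` (V - U))" using assms(1) by (simp add: finite_compl)
  then obtain T where T: "T \<subseteq> - c ` (V - U)" "finite T" "card T = card U"
    using infinite_arbitrarily_large[of "- c ` (V - U)" "card U"] by metis
  then obtain g where g: "bij_betw g U T" using finU finite_same_card_bij by metis
  define c' where "c' v = (if v \<in> U then g v else c v)" for v
  have "c' ` V \<subseteq> T \<union> c ` (V - U)" using g by (auto simp: c'_def bij_betw_def)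
  then have "card (c' ` V) \<le> card (T \<union> c ` (V - U))"
    using assms(1) T(2) by (intro card_mono) auto
  also have "\<dots> \<le> card U + card (c ` (V - U))" using card_Un_le[of T] T(3) by metis
  finally have num: "card (c' ` V) \<le> card U + card (c ` (V - U))" .
  have gc: "g u \<noteq> c v" if "u \<in> U" "v \<in> V - U" for u v
    using that g T(1) by (auto simp: bij_betw_def)
  have "\<exists>i. 1 \<le> card (S \<inter> {v \<in> V. c' v = i}) \<and> card (S \<inter> {v \<in> V. c' v = i}) \<le> k"
    if S: "S \<in> E" "S \<noteq> {}" for S
  proof (cases "S \<inter> U = {}")
    case False
    then obtain u where u: "u \<in> S" "u \<in> U" by auto
    have "S \<inter> {v \<in> V. c' v = g u} = {u}"
    proof -
      have "v = u" if "v \<in> V" "c' v = g u" for v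
        using that u g gc[of u v] by (auto simp: c'_def bij_betw_def inj_on_def split: if_splits)
      then show ?thesis using u assms(2) by (auto simp: c'_def)
    qed
    then show ?thesis using assms(3) by (intro exI[of _ "g u"]) simp
  next
    case True
    then have eq: "(V - U) \<inter> S = S" using S(1) E by auto
    have "S \<in> (\<inter>) (V - U) ` {S \<in> E. S \<inter> U = {}}" using S(1) True eq by (intro image_eqI[of _ _ S]) auto
    with c S(2) obtain i where i: "i \<in> c ` (V - U)"
      "1 \<le> card (S \<inter> {v \<in> V - U. c v = i})" "card (S \<inter> {v \<in> V - U. c v = i}) \<le> k"
      by (elim k_cf_coloringE) auto
    from i(1) have "S \<inter> {v \<in> V. c' v = i} = S \<inter> {v \<in> V - U. c v = i}"
      using True gc by (auto simp: c'_def)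
    then show ?thesis using i by metis
  qed
  then have "k_cf_coloring k V E c'" by (simp add: k_cf_coloring_def)
  then have "chi_k_cf k V E \<le> card (c' ` V)"
    unfolding chi_k_cf_def by (intro Least_le) auto
  with num show ?thesis by simp
qed

text \<open>With threshold \<open>D = 1\<close> the missed hyperedges contain no vertex outside
  \<open>U\<close>, so a single extra color suffices for \<open>V - U\<close>.\<close>

lemma chi_k_cf_le_Suc_card_edges:
  assumes "hypergraph V E" "k \<ge> 1"
  shows "chi_k_cf k V E \<le> card E + 1"
proof -
  have fin: "finite V" "E \<subseteq> Pow V" "finite E"
    using assms(1) finite_subset[of E "Pow V"] by (auto simp: hypergraph_def)
  obtain U where U: "U \<subseteq> V" "1 * real (card U) \<le> real (card E)"
    "\<And>v. v \<in> V - U \<Longrightarrow> real (card {S \<in> {S \<in> E. S \<inter> U = {}}. v \<in> S}) < 1"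
    using exists_degree_reducing_set[OF fin(1,3), of 1] by blast
  have "v \<notin> S" if "v \<in> V - U" "S \<in> E" "S \<inter> U = {}" for v S
  proof
    assume "v \<in> S"
    then have "{S \<in> {S \<in> E. S \<inter> U = {}}. v \<in> S} \<noteq> {}" using that by blast
    then have "card {S \<in> {S \<in> E. S \<inter> U = {}}. v \<in> S} > 0"
      using fin(3) by (subst card_gt_0_iff) simp
    then show False using U(3)[OF that(1)] by linarith
  qed
  then have "X = {}" if "X \<in> (\<inter>) (V - U) ` {S \<in> E. S \<inter> U = {}}" for X
    using that by blast
  then have "k_cf_coloring k (V - U) ((\<inter>) (V - U) ` {S \<in> E. S \<inter> U = {}}) (\<lambda>_. 0)"
    unfolding k_cf_coloring_def by metis
  from chi_k_cf_le_unique_colors[OF fin(1) U(1) assms(2) this fin(2)]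
  have "chi_k_cf k V E \<le> card U + card ((\<lambda>_. 0::nat) ` (V - U))" .
  also have "\<dots> \<le> card E + 1"
    using U(2) card_mono[of "{0::nat}" "(\<lambda>_. 0) ` (V - U)"] by (simp add: image_subset_iff)
  finally show ?thesis .
qed

text \<open>The first term pays for \<open>U\<close>, the others for the rounds on
  \<open>V - U\<close>. Raising \<open>D\<close> shrinks the first but forces a larger
  \<open>r\<close>.\<close>

lemma chi_k_cf_le_degree_threshold:
  fixes D :: real
  assumes "hypergraph V E" "k \<ge> 1" "D > 0" "r \<ge> 1" "D \<le> real r ^ k" "V \<noteq> {}"
  shows "real (chi_k_cf k V E) \<le> real (card E) / D + 2 * real r * ln (real (card V)) + 1"
proof -
  have fin: "finite V" "E \<subseteq> Pow V" "finite E"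
    using assms(1) finite_subset[of E "Pow V"] by (auto simp: hypergraph_def)
  obtain U where U: "U \<subseteq> V" "D * real (card U) \<le> real (card E)"
    "\<And>v. v \<in> V - U \<Longrightarrow> real (card {S \<in> {S \<in> E. S \<inter> U = {}}. v \<in> S}) < D"
    using exists_degree_reducing_set[OF fin(1,3), of D] by blast
  have ln0: "ln (real (card V)) \<ge> 0"
    using assms(6) fin(1) by (simp add: Suc_le_eq card_gt_0_iff)
  obtain c where c: "k_cf_coloring k (V - U) ((\<inter>) (V - U) ` {S \<in> E. S \<inter> U = {}}) c"
    "real (card (c ` (V - U))) \<le> 2 * real r * ln (real (card V)) + 1"
  proof (cases "V - U = {}")
    case True
    then show ?thesis using that[of undefined] ln0 unfolding k_cf_coloring_def True by simp
  next
    case False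
    have "\<exists>c. k_cf_coloring k (V - U) ((\<inter>) (V - U) ` {S \<in> E. S \<inter> U = {}}) c \<and>
        real (card (c ` (V - U))) \<le> 2 * real r * ln (real (card (V - U))) + 1"
      using False fin assms U(3)
      by (intro k_cf_coloring_bounded_degree[where D=D]) (auto intro: less_imp_le)
    moreover have "ln (real (card (V - U))) \<le> ln (real (card V))"
    proof (rule ln_mono)
      have "card (V - U) > 0" using False fin(1) by (subst card_gt_0_iff) simp
      then show "0 < real (card (V - U))" by simp
      show "real (card (V - U)) \<le> real (card V)" using fin(1) by (simp add: card_mono)
    qed
    then have "2 * real r * ln (real (card (V - U))) \<le> 2 * real r * ln (real (card V))"
      by (intro mult_left_mono) auto
    ultimately show ?thesis using that by fastforce
  qed
  have "real (card U) \<le> real (card E) / D" using U(2) assms(3) by (simp add: field_simps)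
  with chi_k_cf_le_unique_colors[OF fin(1) U(1) assms(2) c(1) fin(2)] c(2) show ?thesis
    by linarith
qed

section \<open>Balancing the two costs\<close>

theorem theorem5:
  fixes k :: nat
  assumes "k > 1"
  shows "\<exists>C::real. C > 0 \<and>
    (\<forall>(V::'a set) (E::'a set set) (n::nat) (m::nat).
       hypergraph V E \<longrightarrow> card V = n \<longrightarrow> card E \<le> m \<longrightarrow> n \<ge> 2 \<longrightarrow> m \<ge> 1 \<longrightarrow>
       real (chi_k_cf k V E)
         \<le> C * (real m powr (1 / (real k + 1)) * ln (real n) powr (real k / (real k + 1))))"
\<comment> \<open>The 7 sums the main case: \<open>q\<close> for \<open>card E / D\<close>,
  \<open>4 * q\<close> for \<open>2 * r * L \<le> 2 * q + 2 * L\<close>, and \<open>2 * q\<close>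
  for \<open>1 \<le> 2 * L\<close>.\<close>
proof (intro exI[of _ 7] conjI allI impI)
  fix V :: "'a set" and E :: "'a set set" and n m :: nat
  assume H: "hypergraph V E" "card V = n" "card E \<le> m" "n \<ge> 2" "m \<ge> 1"
  define L where "L = ln (real n)"
  define a where "a = 1 / (real k + 1)"
  define b where "b = real k / (real k + 1)"
  define q where "q = real m powr a * L powr b"
  have ab: "a + b = 1" "a > 0" "b > 0" "b \<le> 1" "b = a * real k"
    using assms by (auto simp: a_def b_def field_simps)
  have "ln 2 \<le> L" using H(4) by (simp add: L_def)
  then have L: "L \<ge> 1/2" using ln_le_minus_one[of "1/2::real"] by (simp add: ln_div)
  have pow_ab: "x powr a * x powr b = x" if "x > 0" for x :: real
    using that ab(1) by (simp flip: powr_add)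
  have "real (chi_k_cf k V E) \<le> 7 * q"
  \<comment> \<open>For \<open>m \<le> L\<close>, \<open>m = m powr a * m powr b \<le> q\<close>,
    and \<open>m + 1 \<le> 2 * m\<close>.\<close>
  proof (cases "real m \<le> L")
    case True
    have "real m = real m powr a * real m powr b" using pow_ab[of "real m"] H(5) by simp
    also have "\<dots> \<le> q"
      unfolding q_def using True ab by (intro mult_left_mono powr_mono2) auto
    finally have "real m \<le> q" .
    moreover have "chi_k_cf k V E \<le> m + 1"
      using chi_k_cf_le_Suc_card_edges[OF H(1), of k] assms H(3) by linarith
    ultimately show ?thesis using H(5) by linarith
  next
    case False
    \<comment> \<open>This \<open>x\<close> solves \<open>m / x ^ k = x * L\<close>, and both sides
      equal \<open>q\<close>. Rounding up to \<open>r\<close> gives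
      \<open>D \<le> r ^ k\<close>.\<close>
    define x where "x = (real m / L) powr a"
    define r where "r = nat \<lceil>x\<rceil>"
    define D where "D = x ^ k"
    have x0: "x > 0" using L H(5) by (simp add: x_def)
    have r: "x \<le> real r" "real r \<le> x + 1" "r \<ge> 1"
      using x0 by (auto simp: r_def of_nat_ceiling) linarith+
    have x_eq: "x * L powr a = real m powr a"
      using L H(5) by (simp add: x_def powr_divide)
    have xL: "x * L = q"
    proof -
      have "x * L = x * L powr a * L powr b" using pow_ab[of L] L by (simp add: mult.assoc)
      then show ?thesis by (simp add: x_eq q_def)
    qed
    have D: "D > 0" "D = (real m / L) powr b"
      using x0 L H(5) by (simp_all add: D_def x_def ab(5) powr_powr flip: powr_realpow)
    have "D * q = real m powr b * real m powr a"
      using D L H(5) by (simp add: q_def powr_divide)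
    then have "D * q = real m" using pow_ab[of "real m"] H(5) by (simp add: mult.commute)
    then have q: "q = real m / D" using D(1) by (simp add: field_simps)
    have "V \<noteq> {}" using H by auto
    have "real (chi_k_cf k V E) \<le> real (card E) / D + 2 * real r * L + 1"
      using chi_k_cf_le_degree_threshold[OF H(1), of k D r] assms D(1) r x0 \<open>V \<noteq> {}\<close> H(2)
      by (simp add: D_def L_def power_mono)
    moreover have "real (card E) / D \<le> q"
      unfolding q using H(3) D(1) by (intro divide_right_mono) auto
    moreover have "real r * L \<le> q + L"
      using mult_right_mono[OF r(2), of L] L by (simp add: distrib_right xL)
    \<comment> \<open>Here \<open>m > L\<close> enters: it gives \<open>L \<le> x * L = q\<close>,
      which absorbs the rounding error in \<open>r\<close>.\<close>
    moreover have "x \<ge> 1" using False L ab(2) by (simp add: x_def ge_one_powr_ge_zero)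
    then have "L \<le> q" using xL L mult_right_mono[of 1 x L] by simp
    ultimately show ?thesis using L by linarith
  qed
  then show "real (chi_k_cf k V E)
      \<le> 7 * (real m powr (1 / (real k + 1)) * ln (real n) powr (real k / (real k + 1)))"
    by (simp add: q_def a_def b_def L_def)
qed simp

end
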